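(* Let $X$ be a finite non-empty set with $N$ elements, let $\tau\in\mathcal{M}_{\geq1}(X)$ have size $L=\|\tau\|\geq N$, and let $\upsilon\in\mathcal{M}(X)$ satisfy $\upsilon\geq\mathbf{1}$. Then $$\mathrm{supp}\Big(\mathrm{PL}^{L-N+1}(\upsilon,\tau)\Big)\subseteq X\qquad\text{and}\qquad\mathrm{PL}^{L-N+1}(\upsilon,\tau)=\mathrm{plff}(\upsilon,\tau).$$ In particular, $\mathrm{plff}(\upsilon,\tau)$ is a probability distribution on $X$, that is, $\sum_{x\in X}\mathrm{plff}(\upsilon,\tau)(x)=1$.
   Context: Multisets. A multiset over $X$ is a function $\varphi\colon X\to\mathbb{N}$ with finite support $\mathrm{supp}(\varphi)=\{x\mid\varphi(x)>0\}$; $\mathcal{M}(X)$ is the set of multisets over $X$; $\|\varphi\|=\sum_x\varphi(x)$; $\mathcal{M}[K](X)=\{\varphi\in\mathcal{M}(X)\mid\|\varphi\|=K\}$. Multisets are added, subtracted and ordered ($\leq$) pointwise; $1|x\rangle$ is the multiset with value $1$ at $x$ and $0$ elsewhere; $\mathbf{1}=\sum_{x\in X}1|x\rangle$. $\mathcal{M}_{\geq1}(X)=\{\tau\in\mathcal{M}(X)\mid\tau\geq\mathbf{1}\}$. Write $\varphi\prec\tau$ ("fully below") if $\varphi(x)<\tau(x)$ for all $x\in X$. Distributions. $\mathcal{D}(A)$ is the set of functions $\omega\colon A\to[0,1]$ with finite support $\mathrm{supp}(\omega)=\{a\mid\omega(a)>0\}$ and $\sum_a\omega(a)=1$, also written as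 formal convex sums $\sum_i r_i|a_i\rangle$. For a non-empty multiset $\varphi$, $\mathrm{Flrn}(\varphi)\in\mathcal{D}(X)$ is the normalisation $\mathrm{Flrn}(\varphi)(x)=\varphi(x)/\|\varphi\|$. Pólya distribution. For $n\geq1$, $m\geq0$ put $\left(\!\binom{n}{m}\!\right)=\binom{n+m-1}{m}$. For a non-empty $\upsilon\in\mathcal{M}(X)$ and $\varphi\in\mathcal{M}[K](\mathrm{supp}(\upsilon))$, $\mathrm{pl}[K](\upsilon)(\varphi)=\prod_{x\in\mathrm{supp}(\upsilon)}\left(\!\binom{\upsilon(x)}{\varphi(x)}\!\right)\Big/\left(\!\binom{\|\upsilon\|}{K}\!\right)$. When $[K]$ is omitted, $K=\|\varphi\|$. Pólya first-full. For $\upsilon,\tau\geq\mathbf{1}$ and $x\in X$, $$\mathrm{plff}(\upsilon,\tau)(x)=\sum_{\varphi\prec\tau,\ \varphi(x)=\tau(x)-1}\mathrm{pl}(\upsilon)(\varphi)\cdot\mathrm{Flrn}(\upsilon+\varphi)(x).$$ Markov models with output. For a function $c\colon Y\to\mathcal{D}(Y+X)$, with $Y+X$ the disjoint union, the iterates $c^n\colon Y\to\mathcal{D}(Y+X)$, $n\in\mathbb{N}$, are given by $c^0(y)=1|y\rangle$ and $$c^{n+1}(y)=\sum_{z\in Y+X}\Big(\sum_{y'\in Y}c(y)(y')\cdot c^n(y')(z)\Big)|z\rangle+\sum_{x\in X}c(y)(x)|x\rangle.$$ The Pólya model $\mathrm{PL}\colon\mathcal{M}_{\geq1}(X)\times\mathcal{M}_{\geq1}(X)\to\mathcal{D}\big(\mathcal{M}_{\geq1}(X)\times\mathcal{M}_{\geq1}(X)+X\big)$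 is $$\mathrm{PL}(\upsilon,\tau)=\sum_{x,\,\tau(x)>1}\mathrm{Flrn}(\upsilon)(x)\,\big|\upsilon+1|x\rangle,\ \tau-1|x\rangle\big\rangle+\sum_{x,\,\tau(x)=1}\mathrm{Flrn}(\upsilon)(x)\,|x\rangle.$$ A distribution on $\mathcal{M}_{\geq1}(X)\times\mathcal{M}_{\geq1}(X)+X$ whose support is contained in the summand $X$ is identified with a distribution on $X$. *)

theory Defs
  imports "HOL-Probability.Probability"
begin

text \<open>The set \<open>X\<close> is a carrier set in a type \<open>'a\<close>. Distributions are values of type \<open>pmf\<close>; all those
  constructed here have finite support. The normalisation \<open>Flrn\<close> of a nonempty multiset is
  \<open>pmf_of_multiset\<close>.\<close>

definition multisets_on :: "'a set \<Rightarrow> 'a multiset set" where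
  "multisets_on X = {\<phi>. set_mset \<phi> \<subseteq> X}"

definition multisets_ge1 :: "'a set \<Rightarrow> 'a multiset set" where
  "multisets_ge1 X = {\<tau> \<in> multisets_on X. \<forall>x\<in>X. 1 \<le> count \<tau> x}"

definition fully_below :: "'a set \<Rightarrow> 'a multiset \<Rightarrow> 'a multiset \<Rightarrow> bool" where
  "fully_below X \<phi> \<tau> \<longleftrightarrow> (\<forall>x\<in>X. count \<phi> x < count \<tau> x)"

lemma finite_fully_below: "finite {\<phi> \<in> multisets_on X. fully_below X \<phi> \<tau>}"
proof (rule finite_subset)
  show "{\<phi> \<in> multisets_on X. fully_below X \<phi> \<tau>} \<subseteq> {\<phi>. \<phi> \<subseteq># \<tau>}"
  proof safe
    fix \<phi> assume *: "\<phi> \<in> multisets_on X" "fully_below X \<phi> \<tau>"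
    show "\<phi> \<subseteq># \<tau>"
    proof (rule mset_subset_eqI)
      fix x show "count \<phi> x \<le> count \<tau> x"
      proof (cases "x \<in> X")
        case False
        then have "x \<notin># \<phi>" using * by (auto simp: multisets_on_def)
        then show ?thesis by (simp add: not_in_iff)
      qed (use * in \<open>auto simp: fully_below_def less_imp_le\<close>)
    qed
  qed
  have "{\<phi>. \<phi> \<subseteq># \<tau>} \<subseteq> mset ` {xs. set xs \<subseteq> set_mset \<tau> \<and> length xs \<le> size \<tau>}"
  proof safe
    fix \<phi> assume "\<phi> \<subseteq># \<tau>"
    moreover obtain xs where "\<phi> = mset xs" by (metis ex_mset)
    ultimately show "\<phi> \<in> mset ` {xs. set xs \<subseteq> set_mset \<tau> \<and> length xs \<le> size \<tau>}"
      using set_mset_mono[of \<phi> \<tau>] size_mset_mono[of \<phi> \<tau>] by auto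
  qed
  then show "finite {\<phi>. \<phi> \<subseteq># \<tau>}"
    by (rule finite_subset) (simp add: finite_lists_length_le)
qed

definition multichoose :: "nat \<Rightarrow> nat \<Rightarrow> nat" where
  "multichoose n m = (n + m - 1) choose m"

text \<open>Meaningful for nonempty \<open>\<upsilon>\<close> and for \<open>\<phi>\<close> of size \<open>K\<close> over the support of \<open>\<upsilon>\<close>.\<close>

definition polya :: "nat \<Rightarrow> 'a multiset \<Rightarrow> 'a multiset \<Rightarrow> real" where
  "polya K \<upsilon> \<phi> =
     (\<Prod>x\<in>set_mset \<upsilon>. real (multichoose (count \<upsilon> x) (count \<phi> x))) / real (multichoose (size \<upsilon>) K)"

definition plff :: "'a set \<Rightarrow> 'a multiset \<Rightarrow> 'a multiset \<Rightarrow> 'a \<Rightarrow> real" where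
  "plff X \<upsilon> \<tau> x =
     (\<Sum>\<phi> | \<phi> \<in> multisets_on X \<and> fully_below X \<phi> \<tau> \<and> count \<phi> x = count \<tau> x - 1.
        polya (size \<phi>) \<upsilon> \<phi> * pmf (pmf_of_multiset (\<upsilon> + \<phi>)) x)"

text \<open>Iteration of a Markov model with output: states are \<open>Inl\<close>, outputs are \<open>Inr\<close>. The lemma
  \<open>pmf_iterate_Suc\<close> gives the iterate pointwise, as an explicit sum.\<close>

primrec model_iterate :: "('y \<Rightarrow> ('y + 'x) pmf) \<Rightarrow> nat \<Rightarrow> 'y \<Rightarrow> ('y + 'x) pmf" where
  "model_iterate c 0 y = return_pmf (Inl y)"
| "model_iterate c (Suc n) y =
     bind_pmf (c y) (\<lambda>s. case s of Inl y' \<Rightarrow> model_iterate c n y' | Inr x \<Rightarrow> return_pmf (Inr x))"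

lemma pmf_iterate_Suc:
  fixes c :: "'y \<Rightarrow> ('y + 'x) pmf"
  assumes "finite (set_pmf (c y))"
  shows "pmf (model_iterate c (Suc n) y) z =
    (\<Sum>y' | Inl y' \<in> set_pmf (c y). pmf (c y) (Inl y') * pmf (model_iterate c n y') z)
      + (case z of Inl _ \<Rightarrow> 0 | Inr x \<Rightarrow> pmf (c y) (Inr x))"
proof -
  define f where "f = (\<lambda>s. case s of Inl y' \<Rightarrow> model_iterate c n y' | Inr x \<Rightarrow> return_pmf (Inr x))"
  define A where "A = {y'. Inl y' \<in> set_pmf (c y)}"
  define B where "B = {x. Inr x \<in> set_pmf (c y)}"
  have S: "set_pmf (c y) = Inl ` A \<union> Inr ` B"
  proof (intro set_eqI)
    fix s show "s \<in> set_pmf (c y) \<longleftrightarrow> s \<in> Inl ` A \<union> Inr ` B"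
      by (cases s) (auto simp: A_def B_def)
  qed
  have fin: "finite A" "finite B"
    using assms unfolding S by (auto simp: finite_image_iff)
  have "pmf (model_iterate c (Suc n) y) z = (\<Sum>s\<in>set_pmf (c y). pmf (c y) s * pmf (f s) z)"
    by (simp add: pmf_bind f_def integral_measure_pmf[OF assms])
  also have "\<dots> = (\<Sum>y'\<in>A. pmf (c y) (Inl y') * pmf (model_iterate c n y') z)
      + (\<Sum>x\<in>B. pmf (c y) (Inr x) * pmf (return_pmf (Inr x)) z)"
    unfolding S using fin
    by (subst sum.union_disjoint) (auto simp: sum.reindex f_def)
  also have "(\<Sum>x\<in>B. pmf (c y) (Inr x) * pmf (return_pmf (Inr x)) z)
      = (case z of Inl _ \<Rightarrow> 0 | Inr x \<Rightarrow> pmf (c y) (Inr x))"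
  proof (cases z)
    case (Inr w)
    have "(\<Sum>x\<in>B. pmf (c y) (Inr x) * pmf (return_pmf (Inr x)) z)
        = (\<Sum>x\<in>B. if x = w then pmf (c y) (Inr x) else 0)"
      by (rule sum.cong) (auto simp: Inr indicator_def)
    then show ?thesis
      using fin by (auto simp: Inr B_def set_pmf_iff)
  qed (auto simp: indicator_def)
  finally show ?thesis by (simp add: A_def)
qed

text \<open>The states of the Polya model are pairs in \<open>multisets_ge1 X \<times> multisets_ge1 X\<close>, on which it
  satisfies \<open>pmf_PL_Inl\<close> and \<open>pmf_PL_Inr\<close>; by \<open>set_pmf_PL\<close> it does not leave this set. Its values on
  other pairs of multisets play no role.\<close>

definition PL :: "'a multiset \<times> 'a multiset \<Rightarrow> ('a multiset \<times> 'a multiset + 'a) pmf" where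
  "PL = (\<lambda>(\<upsilon>, \<tau>).
     map_pmf (\<lambda>x. if 1 < count \<tau> x then Inl (\<upsilon> + {#x#}, \<tau> - {#x#}) else Inr x)
       (pmf_of_multiset \<upsilon>))"

lemma set_mset_multisets_ge1: "\<upsilon> \<in> multisets_ge1 X \<Longrightarrow> set_mset \<upsilon> = X"
  by (force simp: multisets_ge1_def multisets_on_def simp flip: count_greater_zero_iff)

lemma set_pmf_PL:
  assumes "X \<noteq> {}" "\<upsilon> \<in> multisets_ge1 X" "\<tau> \<in> multisets_ge1 X"
  shows "set_pmf (PL (\<upsilon>, \<tau>)) \<subseteq> (multisets_ge1 X \<times> multisets_ge1 X) <+> X"
    and "finite (set_pmf (PL (\<upsilon>, \<tau>)))"
proof -
  have ne: "\<upsilon> \<noteq> {#}" and S: "set_mset \<upsilon> = X"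
    using assms set_mset_multisets_ge1[of \<upsilon> X] by auto
  have u: "add_mset x \<upsilon> \<in> multisets_ge1 X" if "x \<in> X" for x
    using assms that by (auto simp: multisets_ge1_def multisets_on_def)
  have t: "\<tau> - {#x#} \<in> multisets_ge1 X" if "1 < count \<tau> x" for x
  proof -
    have "1 \<le> count (\<tau> - {#x#}) z" if "z \<in> X" for z
      using assms(3) that \<open>1 < count \<tau> x\<close> by (cases "z = x") (auto simp: multisets_ge1_def)
    then show ?thesis
      using assms(3) unfolding multisets_ge1_def multisets_on_def by (blast dest: in_diffD)
  qed
  show "set_pmf (PL (\<upsilon>, \<tau>)) \<subseteq> (multisets_ge1 X \<times> multisets_ge1 X) <+> X"
    using u t by (auto simp: PL_def set_pmf_of_multiset[OF ne] S)
  show "finite (set_pmf (PL (\<upsilon>, \<tau>)))"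
    by (simp add: PL_def set_pmf_of_multiset[OF ne])
qed

lemma pmf_PL:
  assumes "X \<noteq> {}" "\<upsilon> \<in> multisets_ge1 X" "\<tau> \<in> multisets_ge1 X"
  shows pmf_PL_Inl: "pmf (PL (\<upsilon>, \<tau>)) (Inl s) =
      (\<Sum>x | x \<in> X \<and> 1 < count \<tau> x.
         pmf (pmf_of_multiset \<upsilon>) x * of_bool (s = (\<upsilon> + {#x#}, \<tau> - {#x#})))"
    and pmf_PL_Inr: "pmf (PL (\<upsilon>, \<tau>)) (Inr w) =
      (\<Sum>x | x \<in> X \<and> count \<tau> x = 1. pmf (pmf_of_multiset \<upsilon>) x * of_bool (w = x))"
proof -
  have S: "set_mset \<upsilon> = X" and T: "set_mset \<tau> = X"
    using assms(2,3) by (simp_all add: set_mset_multisets_ge1)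
  have ne: "\<upsilon> \<noteq> {#}"
    using S assms(1) by auto
  have fX: "finite X" using S by auto
  let ?f = "\<lambda>x. if 1 < count \<tau> x then Inl (\<upsilon> + {#x#}, \<tau> - {#x#}) else Inr x"
  have *: "pmf (PL (\<upsilon>, \<tau>)) z = (\<Sum>x\<in>X. pmf (pmf_of_multiset \<upsilon>) x * of_bool (?f x = z))" for z
  proof -
    have "pmf (PL (\<upsilon>, \<tau>)) z = measure (measure_pmf (pmf_of_multiset \<upsilon>)) (?f -` {z})"
      by (simp add: PL_def pmf_map)
    also have "\<dots> = measure (measure_pmf (pmf_of_multiset \<upsilon>)) (?f -` {z} \<inter> X)"
      using measure_Int_set_pmf[of "pmf_of_multiset \<upsilon>" "?f -` {z}"]
      by (simp only: set_pmf_of_multiset[OF ne] S)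
    also have "\<dots> = (\<Sum>x\<in>?f -` {z} \<inter> X. pmf (pmf_of_multiset \<upsilon>) x)"
      using fX by (simp add: measure_measure_pmf_finite)
    also have "\<dots> = (\<Sum>x\<in>X. pmf (pmf_of_multiset \<upsilon>) x * of_bool (?f x = z))"
      using fX by (intro sum.mono_neutral_cong_left) auto
    finally show ?thesis .
  qed
  show "pmf (PL (\<upsilon>, \<tau>)) (Inl s) =
      (\<Sum>x | x \<in> X \<and> 1 < count \<tau> x.
         pmf (pmf_of_multiset \<upsilon>) x * of_bool (s = (\<upsilon> + {#x#}, \<tau> - {#x#})))"
    unfolding * using fX by (intro sum.mono_neutral_cong_right) auto
  have "count \<tau> x = 1" if "x \<in> X" "\<not> 1 < count \<tau> x" for x
  proof -
    have "0 < count \<tau> x" using that T by (simp add: count_greater_zero_iff)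
    then show ?thesis using that by linarith
  qed
  then show "pmf (PL (\<upsilon>, \<tau>)) (Inr w) =
      (\<Sum>x | x \<in> X \<and> count \<tau> x = 1. pmf (pmf_of_multiset \<upsilon>) x * of_bool (w = x))"
    unfolding * using fX by (intro sum.mono_neutral_cong_right) auto
qed

end

theory Submission
  imports Defs
begin

text \<open>
  The Polya probability of a multiset \<open>\<phi>\<close> satisfies a first-draw recursion: the draw \<open>y\<close> comes first
  in a fraction \<open>\<phi>(y) / \<parallel>\<phi>\<parallel>\<close> of the orderings of \<open>\<phi>\<close>, all of which are equally likely. Summing over
  the possible first draws, \<open>plff\<close> satisfies the same one-step recursion as the iterates of \<open>PL\<close>; the
  empty multiset accounts for an output in the first step. The claim follows by induction on
  the number of steps, since each non-final step decreases \<open>\<parallel>\<tau>\<parallel> \<ge> N\<close> by one.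
\<close>

text \<open>Both coefficients are binomials with upper index \<open>n + m\<close>, so this is
  binomial absorption. At \<open>n = 0\<close> both sides vanish.\<close>

lemma multichoose_Suc_mult:
  "multichoose (Suc n) m * n = multichoose n (Suc m) * Suc m"
proof -
  have "Suc m * (n + m choose Suc m) = n * (n + m choose m)"
    by (metis add_diff_cancel_right' binomial_absorb_comp binomial_absorption mult.commute)
  then show ?thesis
    by (simp add: multichoose_def mult.commute)
qed

lemma polya_empty: "\<upsilon> \<noteq> {#} \<Longrightarrow> polya 0 \<upsilon> {#} = 1"
  by (simp add: polya_def multichoose_def)

text \<open>Moving one \<open>y\<close> from the draw into the urn changes only the factor at
  \<open>y\<close> and the denominator. \<open>multichoose_Suc_mult\<close> handles both, at
  \<open>count \<upsilon> y\<close> and at \<open>size \<upsilon>\<close>; the quotient of these two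
  numbers is the probability of drawing \<open>y\<close>.\<close>

lemma polya_add_mset:
  assumes y: "y \<in># \<upsilon>"
  shows "pmf (pmf_of_multiset \<upsilon>) y * polya K (add_mset y \<upsilon>) \<phi> =
    polya (Suc K) \<upsilon> (add_mset y \<phi>) * (real (Suc (count \<phi> y)) / real (Suc K))"
proof -
  define R where "R = (\<Prod>x\<in>set_mset \<upsilon> - {y}. real (multichoose (count \<upsilon> x) (count \<phi> x)))"
  have ne: "\<upsilon> \<noteq> {#}" using y by auto
  have set: "set_mset (add_mset y \<upsilon>) = set_mset \<upsilon>" using y by auto
  have 1: "(\<Prod>x\<in>set_mset (add_mset y \<upsilon>). real (multichoose (count (add_mset y \<upsilon>) x) (count \<phi> x)))
      = real (multichoose (Suc (count \<upsilon> y)) (count \<phi> y)) * R"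
    unfolding set R_def by (subst prod.remove[OF _ y]) (auto intro!: prod.cong split: if_splits)
  have 2: "(\<Prod>x\<in>set_mset \<upsilon>. real (multichoose (count \<upsilon> x) (count (add_mset y \<phi>) x)))
      = real (multichoose (count \<upsilon> y) (Suc (count \<phi> y))) * R"
    unfolding R_def by (subst prod.remove[OF _ y]) (auto intro!: prod.cong split: if_splits)
  have num: "real (count \<upsilon> y) * real (multichoose (Suc (count \<upsilon> y)) (count \<phi> y)) =
      real (multichoose (count \<upsilon> y) (Suc (count \<phi> y))) * real (Suc (count \<phi> y))"
    by (metis multichoose_Suc_mult mult.commute of_nat_mult)
  have den: "real (size \<upsilon>) * real (multichoose (Suc (size \<upsilon>)) K) =
      real (multichoose (size \<upsilon>) (Suc K)) * real (Suc K)"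
    by (metis multichoose_Suc_mult mult.commute of_nat_mult)
  have "pmf (pmf_of_multiset \<upsilon>) y * polya K (add_mset y \<upsilon>) \<phi> =
      (real (count \<upsilon> y) * real (multichoose (Suc (count \<upsilon> y)) (count \<phi> y))) * R /
      (real (size \<upsilon>) * real (multichoose (Suc (size \<upsilon>)) K))"
    unfolding polya_def 1 by (simp add: pmf_of_multiset[OF ne])
  also have "\<dots> = polya (Suc K) \<upsilon> (add_mset y \<phi>) * (real (Suc (count \<phi> y)) / real (Suc K))"
    unfolding num den polya_def 2 by simp
  finally show ?thesis .
qed

text \<open>By \<open>polya_add_mset\<close> each summand is the left side times the relative
  frequency of \<open>y\<close> in \<phi>, and these frequencies sum to one.\<close>

lemma polya_first_draw:
  assumes S: "set_mset \<phi> \<subseteq> set_mset \<upsilon>" and ne: "\<phi> \<noteq> {#}"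
  shows "polya (size \<phi>) \<upsilon> \<phi> =
    (\<Sum>y\<in>set_mset \<phi>. pmf (pmf_of_multiset \<upsilon>) y *
       polya (size (\<phi> - {#y#})) (add_mset y \<upsilon>) (\<phi> - {#y#}))"
proof -
  have step: "pmf (pmf_of_multiset \<upsilon>) y * polya (size (\<phi> - {#y#})) (add_mset y \<upsilon>) (\<phi> - {#y#})
      = polya (size \<phi>) \<upsilon> \<phi> * (real (count \<phi> y) / real (size \<phi>))" if y: "y \<in># \<phi>" for y
  proof -
    have "Suc (size (\<phi> - {#y#})) = size \<phi>"
      using y by (metis insert_DiffM size_add_mset)
    moreover have "Suc (count (\<phi> - {#y#}) y) = count \<phi> y"
      using y by (metis count_add_mset insert_DiffM)
    ultimately show ?thesis
      using polya_add_mset[of y \<upsilon> "size (\<phi> - {#y#})" "\<phi> - {#y#}"] y S by auto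
  qed
  have "(\<Sum>y\<in>set_mset \<phi>. real (count \<phi> y) / real (size \<phi>)) = 1"
    using ne multiset_nonemptyE[OF ne]
    by (auto simp: size_multiset_overloaded_eq simp flip: sum_divide_distrib of_nat_sum)
  then show ?thesis
    by (simp add: step del: times_divide_eq_right flip: sum_distrib_left)
qed

lemma finite_plff_index:
  "finite {\<phi>. \<phi> \<in> multisets_on X \<and> fully_below X \<phi> \<tau> \<and> count \<phi> x = k}"
  by (rule finite_subset[OF _ finite_fully_below[of X \<tau>]]) auto

text \<open>This reindexes the draws containing \<open>y\<close> by what remains after the first
  ball. The bound at \<open>y\<close> drops by one on both sides, also if \<open>y = x\<close>;
  there \<open>1 < count \<tau> y\<close> keeps the truncated subtraction exact.\<close>

lemma add_mset_plff_index:
  assumes "y \<in> X" and "1 < count \<tau> y"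
  shows "{\<phi>. \<phi> \<in> multisets_on X \<and> fully_below X \<phi> \<tau> \<and> count \<phi> x = count \<tau> x - 1 \<and> y \<in># \<phi>} =
    add_mset y ` {\<phi>. \<phi> \<in> multisets_on X \<and> fully_below X \<phi> (\<tau> - {#y#}) \<and>
      count \<phi> x = count (\<tau> - {#y#}) x - 1}" (is "?A = add_mset y ` ?B")
proof (intro equalityI subsetI)
  fix \<phi> assume \<phi>: "\<phi> \<in> ?A"
  then have "\<phi> - {#y#} \<in> ?B"
    by (fastforce simp: multisets_on_def fully_below_def dest: in_diffD intro: diff_less_mono)
  moreover have "\<phi> = add_mset y (\<phi> - {#y#})" using \<phi> by simp
  ultimately show "\<phi> \<in> add_mset y ` ?B" by blast
next
  fix \<phi> assume "\<phi> \<in> add_mset y ` ?B"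
  then show "\<phi> \<in> ?A"
    using assms by (fastforce simp: multisets_on_def fully_below_def split: if_splits)
qed

text \<open>Each nonempty draw is split by its first ball and the two sums are swapped. For fixed
  \<open>y\<close> the inner sum is then \<open>plff\<close> at the successor state, or zero if
  \<open>y\<close> has only one place left.\<close>

lemma plff_rec:
  assumes X: "finite X" "X \<noteq> {}" and \<upsilon>: "\<upsilon> \<in> multisets_ge1 X" and \<tau>: "\<tau> \<in> multisets_ge1 X"
    and x: "x \<in> X"
  shows "plff X \<upsilon> \<tau> x =
    (\<Sum>y\<in>X. pmf (pmf_of_multiset \<upsilon>) y *
       (if 1 < count \<tau> y then plff X (add_mset y \<upsilon>) (\<tau> - {#y#}) x else of_bool (x = y)))"
proof -
  define I where "I = {\<phi>. \<phi> \<in> multisets_on X \<and> fully_below X \<phi> \<tau> \<and> count \<phi> x = count \<tau> x - 1}"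
  define F where "F = pmf (pmf_of_multiset \<upsilon>)"
  \<comment> \<open>The second argument of \<open>G\<close> is the draw that remains once
    \<open>y\<close> has been drawn first.\<close>
  define G where "G = (\<lambda>y \<phi>. F y * (polya (size \<phi>) (add_mset y \<upsilon>) \<phi> *
    pmf (pmf_of_multiset (add_mset y \<upsilon> + \<phi>)) x))"
  have set: "set_mset \<upsilon> = X" using \<upsilon> by (rule set_mset_multisets_ge1)
  have ne: "\<upsilon> \<noteq> {#}" using set X by auto
  have ge1: "1 \<le> count \<tau> y" if "y \<in> X" for y
    using \<tau> that by (auto simp: multisets_ge1_def)
  have fin: "finite I" unfolding I_def by (rule finite_plff_index)
  have draw: "polya (size \<phi>) \<upsilon> \<phi> * pmf (pmf_of_multiset (\<upsilon> + \<phi>)) x =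
      (\<Sum>y\<in>X. if y \<in># \<phi> then G y (\<phi> - {#y#}) else 0)" if \<phi>: "\<phi> \<in> I" "\<phi> \<noteq> {#}" for \<phi>
  proof -
    have sub: "set_mset \<phi> \<subseteq> X" using \<phi> by (simp add: I_def multisets_on_def)
    \<comment> \<open>The urn before the last draw does not depend on which ball came first, so the
      factor for the filling draw of \<open>x\<close> is common to all \<open>y\<close>.\<close>
    have eq: "add_mset y \<upsilon> + (\<phi> - {#y#}) = \<upsilon> + \<phi>" if "y \<in># \<phi>" for y
      using that by (metis insert_DiffM union_mset_add_mset_left union_mset_add_mset_right)
    have "polya (size \<phi>) \<upsilon> \<phi> * pmf (pmf_of_multiset (\<upsilon> + \<phi>)) x = (\<Sum>y\<in>set_mset \<phi>. G y (\<phi> - {#y#}))"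
      unfolding polya_first_draw[OF sub[folded set] \<phi>(2)] sum_distrib_right
      by (intro sum.cong refl) (simp only: G_def F_def mult.assoc eq)
    also have "\<dots> = (\<Sum>y\<in>X. if y \<in># \<phi> then G y (\<phi> - {#y#}) else 0)"
      using sub X by (intro sum.mono_neutral_cong_left) auto
    finally show ?thesis .
  qed
  have inner: "(\<Sum>\<phi>\<in>I. if y \<in># \<phi> then G y (\<phi> - {#y#}) else 0) =
      (if 1 < count \<tau> y then F y * plff X (add_mset y \<upsilon>) (\<tau> - {#y#}) x else 0)"
    if y: "y \<in> X" for y
  proof (cases "1 < count \<tau> y")
    case True
    have "(\<Sum>\<phi>\<in>I. if y \<in># \<phi> then G y (\<phi> - {#y#}) else 0) =
        (\<Sum>\<phi> | \<phi> \<in> multisets_on X \<and> fully_below X \<phi> \<tau> \<and> count \<phi> x = count \<tau> x - 1 \<and> y \<in># \<phi>.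
          G y (\<phi> - {#y#}))"
      using fin by (intro sum.mono_neutral_cong_right) (auto simp: I_def)
    also have "\<dots> = F y * plff X (add_mset y \<upsilon>) (\<tau> - {#y#}) x"
      unfolding add_mset_plff_index[OF y True]
      by (subst sum.reindex) (auto simp: plff_def G_def sum_distrib_left inj_on_def)
    finally show ?thesis using True by simp
  next
    \<comment> \<open>A single \<open>y\<close> would already fill its place, so no draw in
      \<open>I\<close> contains it.\<close>
    case False
    have "y \<notin># \<phi>" if "\<phi> \<in> I" for \<phi>
    proof -
      have "count \<phi> y < count \<tau> y" using that y by (simp add: I_def fully_below_def)
      then show ?thesis using False by (simp add: not_in_iff)
    qed
    then show ?thesis using False by simp
  qed
  \<comment> \<open>The empty draw counts exactly when the first ball \<open>x\<close> already fills
    its place.\<close>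
  have empty: "{#} \<in> I \<longleftrightarrow> \<not> 1 < count \<tau> x"
    using ge1 x by (force simp: I_def multisets_on_def fully_below_def)
  have "plff X \<upsilon> \<tau> x = (\<Sum>\<phi>\<in>I. polya (size \<phi>) \<upsilon> \<phi> * pmf (pmf_of_multiset (\<upsilon> + \<phi>)) x)"
    by (simp add: plff_def I_def)
  also have "\<dots> = (\<Sum>\<phi>\<in>I. (if \<phi> = {#} then F x else 0) +
      (\<Sum>y\<in>X. if y \<in># \<phi> then G y (\<phi> - {#y#}) else 0))"
  proof (intro sum.cong refl)
    fix \<phi> assume "\<phi> \<in> I"
    then show "polya (size \<phi>) \<upsilon> \<phi> * pmf (pmf_of_multiset (\<upsilon> + \<phi>)) x =
        (if \<phi> = {#} then F x else 0) + (\<Sum>y\<in>X. if y \<in># \<phi> then G y (\<phi> - {#y#}) else 0)"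
      using draw[of \<phi>]
      by (cases "\<phi> = {#}") (simp add: polya_empty[OF ne] F_def, simp only: if_False add_0 simp_thms)
  qed
  also have "\<dots> = (if 1 < count \<tau> x then 0 else F x) +
      (\<Sum>y\<in>X. \<Sum>\<phi>\<in>I. if y \<in># \<phi> then G y (\<phi> - {#y#}) else 0)"
    using fin empty by (simp add: sum.distrib sum.swap[of _ X I])
  \<comment> \<open>The single output term is spread over \<open>X\<close> so that it merges with
    the sum over first balls.\<close>
  also have "(if 1 < count \<tau> x then 0 else F x) =
      (\<Sum>y\<in>X. if 1 < count \<tau> y then 0 else F y * of_bool (x = y))"
  proof -
    have "(\<Sum>y\<in>X. if 1 < count \<tau> y then 0 else F y * of_bool (x = y)) =
        (\<Sum>y\<in>X. if y = x then (if 1 < count \<tau> x then 0 else F x) else 0)"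
      by (intro sum.cong) auto
    then show ?thesis using X x by simp
  qed
  also have "\<dots> + (\<Sum>y\<in>X. \<Sum>\<phi>\<in>I. if y \<in># \<phi> then G y (\<phi> - {#y#}) else 0) =
      (\<Sum>y\<in>X. F y * (if 1 < count \<tau> y then plff X (add_mset y \<upsilon>) (\<tau> - {#y#}) x else of_bool (x = y)))"
    unfolding sum.distrib[symmetric] by (intro sum.cong) (auto simp: inner)
  finally show ?thesis unfolding F_def .
qed

text \<open>Fusing the \<open>map_pmf\<close> in \<open>PL\<close> with the bind lets the step range
  over drawn balls instead of successor states, which matches the shape of
  \<open>plff_rec\<close>.\<close>

lemma model_iterate_PL_Suc:
  "model_iterate PL (Suc n) (\<upsilon>, \<tau>) =
    bind_pmf (pmf_of_multiset \<upsilon>) (\<lambda>y. if 1 < count \<tau> y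
      then model_iterate PL n (add_mset y \<upsilon>, \<tau> - {#y#}) else return_pmf (Inr y))"
  by (auto simp: PL_def bind_map_pmf intro!: bind_pmf_cong)

lemma add_mset_multisets_ge1:
  "\<upsilon> \<in> multisets_ge1 X \<Longrightarrow> y \<in> X \<Longrightarrow> add_mset y \<upsilon> \<in> multisets_ge1 X"
  by (auto simp: multisets_ge1_def multisets_on_def)

lemma diff_multisets_ge1:
  assumes "\<tau> \<in> multisets_ge1 X" and "1 < count \<tau> y"
  shows "\<tau> - {#y#} \<in> multisets_ge1 X"
proof -
  have "1 \<le> count (\<tau> - {#y#}) z" if "z \<in> X" for z
    using assms that by (cases "z = y") (auto simp: multisets_ge1_def)
  then show ?thesis
    using assms(1) unfolding multisets_ge1_def multisets_on_def by (blast dest: in_diffD)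
qed

lemma card_le_size_multisets_ge1:
  "\<tau> \<in> multisets_ge1 X \<Longrightarrow> card X \<le> size \<tau>"
  by (metis set_mset_multisets_ge1 mset_set_set_mset_msubset size_mset_mono size_mset_set)

text \<open>A strict bound on \<open>size \<tau>\<close> instead of an exact step count avoids
  natural subtraction and is inherited by every successor state.\<close>

lemma model_iterate_PL:
  assumes X: "finite X" "X \<noteq> {}" and "\<upsilon> \<in> multisets_ge1 X" and "\<tau> \<in> multisets_ge1 X"
    and "size \<tau> < card X + n"
  shows "set_pmf (model_iterate PL n (\<upsilon>, \<tau>)) \<subseteq> Inr ` X"
    and "x \<in> X \<Longrightarrow> pmf (model_iterate PL n (\<upsilon>, \<tau>)) (Inr x) = plff X \<upsilon> \<tau> x"
proof -
  have "set_pmf (model_iterate PL n (\<upsilon>, \<tau>)) \<subseteq> Inr ` X \<and>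
      (\<forall>x\<in>X. pmf (model_iterate PL n (\<upsilon>, \<tau>)) (Inr x) = plff X \<upsilon> \<tau> x)"
    using assms(3-5)
  proof (induction n arbitrary: \<upsilon> \<tau>)
    case 0
    \<comment> \<open>With no steps the bound would give \<open>size \<tau> < card X\<close>, so
      this case is vacuous.\<close>
    then show ?case using card_le_size_multisets_ge1[of \<tau> X] by simp
  next
    case (Suc n)
    have set: "set_mset \<upsilon> = X" using Suc.prems(1) by (rule set_mset_multisets_ge1)
    have ne: "\<upsilon> \<noteq> {#}" using set X by auto
    have set_pmf: "set_pmf (pmf_of_multiset \<upsilon>) = X" using ne set by simp
    have IH: "set_pmf (model_iterate PL n (add_mset y \<upsilon>, \<tau> - {#y#})) \<subseteq> Inr ` X \<and>
        (\<forall>x\<in>X. pmf (model_iterate PL n (add_mset y \<upsilon>, \<tau> - {#y#})) (Inr x) =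
          plff X (add_mset y \<upsilon>) (\<tau> - {#y#}) x)" if y: "y \<in> X" "1 < count \<tau> y" for y
    proof (rule Suc.IH)
      have "y \<in># \<tau>" using y(2) by (simp flip: count_greater_zero_iff)
      then have "Suc (size (\<tau> - {#y#})) = size \<tau>" by (metis insert_DiffM size_add_mset)
      then show "size (\<tau> - {#y#}) < card X + n" using Suc.prems(3) by simp
    qed (use y Suc.prems in \<open>auto intro: add_mset_multisets_ge1 diff_multisets_ge1\<close>)
    have "set_pmf (model_iterate PL (Suc n) (\<upsilon>, \<tau>)) \<subseteq> Inr ` X"
      using IH unfolding model_iterate_PL_Suc by (fastforce simp: set_pmf split: if_splits)
    moreover have "pmf (model_iterate PL (Suc n) (\<upsilon>, \<tau>)) (Inr x) = plff X \<upsilon> \<tau> x" if x: "x \<in> X" for x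
    proof -
      have "pmf (model_iterate PL (Suc n) (\<upsilon>, \<tau>)) (Inr x) =
          (\<Sum>y\<in>X. pmf (pmf_of_multiset \<upsilon>) y * pmf (if 1 < count \<tau> y
            then model_iterate PL n (add_mset y \<upsilon>, \<tau> - {#y#}) else return_pmf (Inr y)) (Inr x))"
        unfolding model_iterate_PL_Suc pmf_bind
        by (subst integral_measure_pmf[OF X(1)]) (simp_all add: ne set)
      also have "\<dots> = plff X \<upsilon> \<tau> x"
        unfolding plff_rec[OF X Suc.prems(1,2) x]
        using IH x by (intro sum.cong) (auto simp: indicator_def)
      finally show ?thesis .
    qed
    ultimately show ?case by blast
  qed
  then show "set_pmf (model_iterate PL n (\<upsilon>, \<tau>)) \<subseteq> Inr ` X"
    and "x \<in> X \<Longrightarrow> pmf (model_iterate PL n (\<upsilon>, \<tau>)) (Inr x) = plff X \<upsilon> \<tau> x"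
    by blast+
qed

theorem theorem11:
  fixes X :: "'a set" and \<upsilon> \<tau> :: "'a multiset" and N L :: nat
  assumes "finite X" and "X \<noteq> {}" and "card X = N"
    and "\<tau> \<in> multisets_ge1 X" and "size \<tau> = L" and "N \<le> L"
    and "\<upsilon> \<in> multisets_ge1 X"
  shows "set_pmf (model_iterate PL (L - N + 1) (\<upsilon>, \<tau>)) \<subseteq> Inr ` X
    \<and> (\<forall>x\<in>X. pmf (model_iterate PL (L - N + 1) (\<upsilon>, \<tau>)) (Inr x) = plff X \<upsilon> \<tau> x)
    \<and> (\<Sum>x\<in>X. plff X \<upsilon> \<tau> x) = 1"
proof -
  let ?P = "model_iterate PL (L - N + 1) (\<upsilon>, \<tau>)"
  \<comment> \<open>\<open>L - N + 1\<close> is the least number of steps that satisfies the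
    bound.\<close>
  have "size \<tau> < card X + (L - N + 1)" using assms by simp
  note PL = model_iterate_PL[OF assms(1,2,7,4) this]
  \<comment> \<open>The whole mass of \<open>?P\<close> lies on outputs, so the total of
    \<open>plff\<close> is that of a distribution.\<close>
  have "(\<Sum>x\<in>X. plff X \<upsilon> \<tau> x) = (\<Sum>z\<in>Inr ` X. pmf ?P z)"
    using PL(2) by (simp add: sum.reindex inj_on_def)
  also have "\<dots> = 1" using assms(1) PL(1) by (intro sum_pmf_eq_1) auto
  finally show ?thesis using PL by blast
qed

end
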